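(* Let $\mathfrak g$ be a simple Lie algebra and $\mathbf i=i_1i_2\cdots i_N$ an arbitrary reduced word of the longest element $w_0$ of its Weyl group. Let $\mathbb B_{\mathbf i}$, $\mathcal H_{\mathbf i}$ and $B(\infty)_{\mathbf i}\subset\mathbb B_{\mathbf i}$ be as in the context, and for $h\in\mathcal H_{\mathbf i}$ put $B^h(\infty)_{\mathbf i}=\{x+h\in\mathbb Z^N(=\mathbb B_{\mathbf i}) : x\in B(\infty)_{\mathbf i}\}\subset\mathbb B_{\mathbf i}$. Then: (1) For any $x+h\in B^h(\infty)_{\mathbf i}$ and $i\in I$, $\tilde e_i(x+h)=\tilde e_i(x)+h$ and $\tilde f_i(x+h)=\tilde f_i(x)+h$, where $\tilde e_i,\tilde f_i$ denote the operators of $\mathbb B_{\mathbf i}$ (so that $\tilde e_i(x)$ is taken in $\mathbb B_{\mathbf i}$ and never vanishes). (2) For any $h\in\mathcal H_{\mathbf i}$, $B(\infty)_{\mathbf i}\cap B^h(\infty)_{\mathbf i}\neq\emptyset$. (3) $\mathbb B_{\mathbf i}=\bigcup_{h\in\mathcal H_{\mathbf i}}B^h(\infty)_{\mathbf i}$.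
   Context: $\mathfrak g$ has index set $I$, simple roots $\alpha_i$, simple coroots $h_i$, Cartan matrix $a_{ij}=\langle h_i,\alpha_j\rangle$. For a reduced word $\mathbf i=i_1\cdots i_N$ of $w_0$, the cellular crystal $\mathbb B_{\mathbf i}=B_{i_1}\otimes\cdots\otimes B_{i_N}$ (with $B_i=\{(n)_i:n\in\mathbb Z\}$ the elementary crystals) is identified with $\mathbb Z^N$ by $(x_1,\dots,x_N)=(-x_1)_{i_1}\otimes\cdots\otimes(-x_N)_{i_N}$; addition is that of $\mathbb Z^N$. Its crystal structure is explicitly: $\sigma_k(x)=x_k+\sum_{j<k}\langle h_{i_k},\alpha_{i_j}\rangle x_j$; $\mathrm{wt}(x)=-\sum_kx_k\alpha_{i_k}$; $\varepsilon_i(x)=\max\{\sigma_k(x):i_k=i\}$; $\varphi_i(x)=\langle h_i,\mathrm{wt}(x)\rangle+\varepsilon_i(x)$; $\tilde f_i(x)$ is obtained from $x$ by adding $1$ to the coordinate $x_k$ with $k$ the largest index such that $i_k=i$ and $\sigma_k(x)=\varepsilon_i(x)$; $\tilde e_i(x)$ by subtracting $1$ from $x_k$ with $k$ the smallest such index. For $k\in[1,N]$ let $k^+$ be the smallest $j>k$ with $i_j=i_k$ (or $N+1$ if none), and $\beta^{(\mathbf i)}_k(x)=x_k+\sum_{k<j<k^+}\langle h_{i_k},\alpha_{i_j}\rangle x_j+x_{k^+}$. Define $\mathcal H_{\mathbf i}=\{x\in\mathbb Z^N:\beta^{(\mathbf i)}_k(x)=0\text{ for every }k\text{ with }k^+\le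 N\}$. $B(\infty)$ is Kashiwara's crystal of $U_q^-(\mathfrak g)$, with highest element $u_\infty$. $B(\infty)_{\mathbf i}\subset\mathbb B_{\mathbf i}$ denotes its realization in $\mathbb B_{\mathbf i}$: the image of the injective map $B(\infty)\to\mathbb B_{\mathbf i}$, $\tilde f_{j_1}\cdots\tilde f_{j_l}u_\infty\mapsto\tilde f_{j_1}\cdots\tilde f_{j_l}(0,\dots,0)$. (In $B(\infty)$ one sets $\tilde e_ix=0$ when $\tilde e_ix\notin B(\infty)_{\mathbf i}$, but in this statement $\tilde e_i$ is always computed in $\mathbb B_{\mathbf i}$.) *)

theory Defs
  imports Complex_Main "HOL-Library.Function_Algebras"
begin

text \<open>
  A simple Lie algebra enters only through its Cartan matrix \<open>a i j = \<langle>h\<^sub>i, \<alpha>\<^sub>j\<rangle>\<close>, indexed by the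
  finite index set \<open>I\<close> of simple roots, here the type \<^typ>\<open>'i\<close>. The Cartan matrices of simple Lie
  algebras are exactly the indecomposable Cartan matrices of finite type.
\<close>

definition cartan_matrix :: "('i::finite \<Rightarrow> 'i \<Rightarrow> int) \<Rightarrow> bool" where
  "cartan_matrix a \<longleftrightarrow>
     (\<forall>i. a i i = 2) \<and>
     (\<forall>i j. i \<noteq> j \<longrightarrow> a i j \<le> 0) \<and>
     (\<forall>i j. a i j = 0 \<longleftrightarrow> a j i = 0)"

definition finite_type :: "('i::finite \<Rightarrow> 'i \<Rightarrow> int) \<Rightarrow> bool" where
  "finite_type a \<longleftrightarrow>
     (\<exists>d :: 'i \<Rightarrow> int.
        (\<forall>i. d i > 0) \<and>
        (\<forall>i j. d i * a i j = d j * a j i) \<and>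
        (\<forall>v :: 'i \<Rightarrow> real. v \<noteq> 0 \<longrightarrow>
           (\<Sum>i\<in>UNIV. \<Sum>j\<in>UNIV. of_int (d i * a i j) * v i * v j) > 0))"

definition indecomposable :: "('i::finite \<Rightarrow> 'i \<Rightarrow> int) \<Rightarrow> bool" where
  "indecomposable a \<longleftrightarrow>
     (\<forall>J. J \<noteq> {} \<and> J \<noteq> UNIV \<longrightarrow> (\<exists>i\<in>J. \<exists>j\<in>-J. a i j \<noteq> 0))"

definition simple_cartan_matrix :: "('i::finite \<Rightarrow> 'i \<Rightarrow> int) \<Rightarrow> bool" where
  "simple_cartan_matrix a \<longleftrightarrow> cartan_matrix a \<and> finite_type a \<and> indecomposable a"

text \<open>
  The Weyl group acts faithfully on the root lattice; \<open>c :: 'i \<Rightarrow> int\<close> stands for the element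
  \<open>\<Sum>\<^sub>j c j \<alpha>\<^sub>j\<close>. The simple reflection is \<open>s\<^sub>i(\<lambda>) = \<lambda> - \<langle>h\<^sub>i, \<lambda>\<rangle> \<alpha>\<^sub>i\<close>. Simple reflections are
  involutions, so the products of words already form the group they generate.
\<close>

definition simple_reflection ::
    "('i::finite \<Rightarrow> 'i \<Rightarrow> int) \<Rightarrow> 'i \<Rightarrow> ('i \<Rightarrow> int) \<Rightarrow> ('i \<Rightarrow> int)" where
  "simple_reflection a i c = c(i := c i - (\<Sum>j\<in>UNIV. a i j * c j))"

definition word_product ::
    "('i::finite \<Rightarrow> 'i \<Rightarrow> int) \<Rightarrow> 'i list \<Rightarrow> ('i \<Rightarrow> int) \<Rightarrow> ('i \<Rightarrow> int)" where
  "word_product a w = foldr (\<lambda>i g. simple_reflection a i \<circ> g) w id"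

definition weyl_group :: "('i::finite \<Rightarrow> 'i \<Rightarrow> int) \<Rightarrow> (('i \<Rightarrow> int) \<Rightarrow> ('i \<Rightarrow> int)) set" where
  "weyl_group a = range (word_product a)"

definition weyl_length ::
    "('i::finite \<Rightarrow> 'i \<Rightarrow> int) \<Rightarrow> (('i \<Rightarrow> int) \<Rightarrow> ('i \<Rightarrow> int)) \<Rightarrow> nat" where
  "weyl_length a g = (LEAST n. \<exists>w. length w = n \<and> word_product a w = g)"

definition longest_element ::
    "('i::finite \<Rightarrow> 'i \<Rightarrow> int) \<Rightarrow> (('i \<Rightarrow> int) \<Rightarrow> ('i \<Rightarrow> int)) \<Rightarrow> bool" where
  "longest_element a g \<longleftrightarrow>
     g \<in> weyl_group a \<and> (\<forall>g'\<in>weyl_group a. weyl_length a g' \<le> weyl_length a g)"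

definition reduced_word ::
    "('i::finite \<Rightarrow> 'i \<Rightarrow> int) \<Rightarrow> (('i \<Rightarrow> int) \<Rightarrow> ('i \<Rightarrow> int)) \<Rightarrow> 'i list \<Rightarrow> bool" where
  "reduced_word a g w \<longleftrightarrow> word_product a w = g \<and> length w = weyl_length a g"

text \<open>
  Positions in a word are counted from 0, as for lists: the letter \<open>i\<^sub>k\<close> and the coordinate \<open>x\<^sub>k\<close>
  of the usual 1-based notation are \<open>w ! (k - 1)\<close> and \<open>x (k - 1)\<close>. A point of \<open>\<int>\<^sup>N\<close>, where \<open>N\<close> is
  the length of \<open>w\<close>, is a function on \<^typ>\<open>nat\<close> vanishing from \<open>N\<close> on; addition is pointwise.
  The point \<open>x\<close> stands for \<open>(-x\<^sub>1)\<^bsub>i\<^sub>1\<^esub> \<otimes> \<dots> \<otimes> (-x\<^sub>N)\<^bsub>i\<^sub>N\<^esub>\<close>.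
\<close>

definition cellular_crystal :: "'i list \<Rightarrow> (nat \<Rightarrow> int) set" where
  "cellular_crystal w = {x. \<forall>k\<ge>length w. x k = 0}"

definition sigma ::
    "('i \<Rightarrow> 'i \<Rightarrow> int) \<Rightarrow> 'i list \<Rightarrow> nat \<Rightarrow> (nat \<Rightarrow> int) \<Rightarrow> int" where
  "sigma a w k x = x k + (\<Sum>j<k. a (w ! k) (w ! j) * x j)"

text \<open>
  Here \<^term>\<open>Max\<close> and \<^term>\<open>Min\<close> range over nonempty sets as soon as \<open>i\<close> occurs in \<open>w\<close>, which is
  the case for every \<open>i\<close> when \<open>w\<close> is a reduced word of the longest element.
\<close>

definition eps ::
    "('i \<Rightarrow> 'i \<Rightarrow> int) \<Rightarrow> 'i list \<Rightarrow> 'i \<Rightarrow> (nat \<Rightarrow> int) \<Rightarrow> int" where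
  "eps a w i x = Max {sigma a w k x | k. k < length w \<and> w ! k = i}"

definition eps_positions ::
    "('i \<Rightarrow> 'i \<Rightarrow> int) \<Rightarrow> 'i list \<Rightarrow> 'i \<Rightarrow> (nat \<Rightarrow> int) \<Rightarrow> nat set" where
  "eps_positions a w i x = {k. k < length w \<and> w ! k = i \<and> sigma a w k x = eps a w i x}"

definition f_op ::
    "('i \<Rightarrow> 'i \<Rightarrow> int) \<Rightarrow> 'i list \<Rightarrow> 'i \<Rightarrow> (nat \<Rightarrow> int) \<Rightarrow> (nat \<Rightarrow> int)" where
  "f_op a w i x = (let k = Max (eps_positions a w i x) in x(k := x k + 1))"

definition e_op ::
    "('i \<Rightarrow> 'i \<Rightarrow> int) \<Rightarrow> 'i list \<Rightarrow> 'i \<Rightarrow> (nat \<Rightarrow> int) \<Rightarrow> (nat \<Rightarrow> int)" where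
  "e_op a w i x = (let k = Min (eps_positions a w i x) in x(k := x k - 1))"

text \<open>
  The position \<open>k\<^sup>+\<close> of the next occurrence of the letter at \<open>k\<close>; it is \<open>length w\<close> if there is none.
\<close>

definition next_pos :: "'i list \<Rightarrow> nat \<Rightarrow> nat" where
  "next_pos w k = (LEAST j. k < j \<and> (j < length w \<longrightarrow> w ! j = w ! k))"

definition beta ::
    "('i \<Rightarrow> 'i \<Rightarrow> int) \<Rightarrow> 'i list \<Rightarrow> nat \<Rightarrow> (nat \<Rightarrow> int) \<Rightarrow> int" where
  "beta a w k x =
     x k + (\<Sum>j\<in>{k<..<next_pos w k}. a (w ! k) (w ! j) * x j) + x (next_pos w k)"

definition H_lattice :: "('i \<Rightarrow> 'i \<Rightarrow> int) \<Rightarrow> 'i list \<Rightarrow> (nat \<Rightarrow> int) set" where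
  "H_lattice a w =
     {x \<in> cellular_crystal w. \<forall>k<length w. next_pos w k < length w \<longrightarrow> beta a w k x = 0}"

text \<open>
  The realization of \<open>B(\<infinity>)\<close> is the image of the map
  \<open>f\<^bsub>j\<^sub>1\<^esub> \<cdots> f\<^bsub>j\<^sub>l\<^esub> u\<^sub>\<infinity> \<mapsto> f\<^bsub>j\<^sub>1\<^esub> \<cdots> f\<^bsub>j\<^sub>l\<^esub> (0, \<dots>, 0)\<close>. The elements of \<open>B(\<infinity>)\<close> are the
  \<open>f\<^bsub>j\<^sub>1\<^esub> \<cdots> f\<^bsub>j\<^sub>l\<^esub> u\<^sub>\<infinity>\<close> for arbitrary words \<open>j\<^sub>1 \<dots> j\<^sub>l\<close> (the \<open>f\<^sub>j\<close> never vanish on \<open>B(\<infinity>)\<close>),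
  so the image consists of the right-hand sides for all words.
\<close>

definition B_infinity :: "('i \<Rightarrow> 'i \<Rightarrow> int) \<Rightarrow> 'i list \<Rightarrow> (nat \<Rightarrow> int) set" where
  "B_infinity a w = {foldr (f_op a w) js 0 | js. True}"

definition B_infinity_shift ::
    "('i \<Rightarrow> 'i \<Rightarrow> int) \<Rightarrow> 'i list \<Rightarrow> (nat \<Rightarrow> int) \<Rightarrow> (nat \<Rightarrow> int) set" where
  "B_infinity_shift a w h = {x + h | x. x \<in> B_infinity a w}"

end

theory Submission
  imports Defs
begin

text \<open>
  Adding a point \<open>h\<close> commutes with the crystal operators as soon as \<open>\<sigma>\<^sub>k(h)\<close> depends only on the
  letter at \<open>k\<close>: all the numbers \<open>\<sigma>\<^sub>k(x)\<close> competing for the maximum that defines \<open>\<epsilon>\<^sub>i\<close> then move by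
  the same amount. As \<open>\<sigma>\<close> at the next occurrence of the letter minus \<open>\<sigma>\<^sub>k\<close> is \<open>\<beta>\<^sub>k\<close>, the lattice \<open>\<H>\<close>
  consists of exactly these points, which gives the first claim.

  The other two claims follow from one assertion: for a suitable \<open>h \<in> \<H>\<close>, every point \<open>y\<close> of the
  cellular crystal satisfies \<open>y + n h \<in> B(\<infinity>)\<close> for all large \<open>n\<close>
  (\<open>deep_shift_in_B_infinity\<close>). Indeed \<open>y = (y + n h) + (- n h)\<close> shows that the translates cover, and
  for \<open>g \<in> \<H>\<close> the point \<open>n h + g\<close>, with \<open>n\<close> so large that \<open>n h\<close> and \<open>g + n h\<close> are both in \<open>B(\<infinity>)\<close>,
  is common to \<open>B(\<infinity>)\<close> and its translate by \<open>g\<close>.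

  The assertion holds for every \<open>h \<in> \<H>\<close> with all coordinates positive. To see that a point is in
  \<open>B(\<infinity>)\<close> it suffices to lower it to \<open>0\<close> by inverses of the \<open>f\<^sub>i\<close>, and this can be done coordinate by
  coordinate from the left. Suppose the coordinates before \<open>k\<close> are already \<open>0\<close>. The inverse of \<open>f\<^sub>i\<close>
  for the letter \<open>i\<close> at \<open>k\<close> first lowers later occurrences of \<open>i\<close>, until \<open>\<sigma>\<^sub>k\<close> is maximal, and from
  then on lowers only the \<open>k\<close>-th coordinate, down to \<open>0\<close>. Replacing \<open>y\<close> by \<open>y + n h\<close> adds the same
  amount \<open>n h\<^sub>k\<close> to all \<open>\<sigma>\<close> of that letter from \<open>k\<close> on, so the later coordinates are lowered by
  amounts independent of \<open>n\<close>. Hence a large \<open>n\<close> keeps every coordinate positive until its turn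
  comes.

  A positive element of \<open>\<H>\<close> is given by the heights of the coroots
  \<open>s\<^bsub>i\<^sub>1\<^esub> \<cdots> s\<^bsub>i\<^sub>k\<^sub>-\<^sub>1\<^esub> h\<^bsub>i\<^sub>k\<^esub>\<close>: all their \<open>\<sigma>\<^sub>k\<close> are \<open>1\<close>, and they are positive because the word is reduced.
  The latter rests on the fact that the coefficients of a root have one sign
  (\<open>root_nonneg_or_nonpos\<close>), proved here from positive definiteness, and on the deletion property
  derived from it. The same two facts show that a reduced word of the longest element contains every
  letter, which keeps the \<open>f\<^sub>i\<close> inside the cellular crystal.
\<close>


section \<open>Roots\<close>

definition simple_root :: "'i \<Rightarrow> 'i \<Rightarrow> int" where
  "simple_root i = (\<lambda>j. if j = i then 1 else 0)"

lemma word_product_Nil [simp]: "word_product a [] = id"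
  and word_product_Cons [simp]:
    "word_product a (j # v) = simple_reflection a j \<circ> word_product a v"
  by (simp_all add: word_product_def)

lemma word_product_append:
  "word_product a (u @ v) = word_product a u \<circ> word_product a v"
  by (induction u) (simp_all add: comp_assoc)

lemma simple_reflection_alt:
  "simple_reflection a i c =
     (\<lambda>j. c j + (- (\<Sum>l\<in>UNIV. a i l * c l)) * simple_root i j)"
  by (auto simp: simple_reflection_def simple_root_def fun_eq_iff)

lemma simple_reflection_linear:
  "simple_reflection a i (\<lambda>j. x j + k * y j) =
     (\<lambda>j. simple_reflection a i x j + k * simple_reflection a i y j)"
  by (auto simp: simple_reflection_def fun_eq_iff algebra_simps sum.distrib sum_distrib_left)

lemma word_product_linear:
  "word_product a v (\<lambda>j. x j + k * y j) =
     (\<lambda>j. word_product a v x j + k * word_product a v y j)"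
  by (induction v) (simp_all add: simple_reflection_linear)

lemma word_product_reflection:
  "word_product a v (simple_reflection a i x) =
     (\<lambda>j. word_product a v x j
        + (- (\<Sum>l\<in>UNIV. a i l * x l)) * word_product a v (simple_root i) j)"
  unfolding simple_reflection_alt word_product_linear ..

lemma word_product_absent_letter:
  "i \<notin> set v \<Longrightarrow> word_product a v x i = x i"
  by (induction v) (auto simp: simple_reflection_def)

text \<open>
  Off-diagonal terms come in equal pairs, which supplies the extra factor 2.
\<close>

lemma dvd_double_sum_symmetric:
  fixes f :: "'b \<Rightarrow> 'b \<Rightarrow> int"
  assumes "finite S" and "\<And>i j. f i j = f j i"
    and "\<And>i j. e dvd f i j" and "\<And>i. 2 * e dvd f i i"
  shows "2 * e dvd (\<Sum>i\<in>S. \<Sum>j\<in>S. f i j)"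
  using assms(1)
proof (induction S rule: finite_induct)
  case (insert x S)
  have sw: "(\<Sum>i\<in>S. f i x) = (\<Sum>i\<in>S. f x i)"
    by (intro sum.cong refl assms(2))
  have "(\<Sum>i\<in>insert x S. \<Sum>j\<in>insert x S. f i j)
      = f x x + 2 * (\<Sum>j\<in>S. f x j) + (\<Sum>i\<in>S. \<Sum>j\<in>S. f i j)"
    using insert.hyps by (simp add: sum.distrib sw)
  moreover have "2 * e dvd 2 * (\<Sum>j\<in>S. f x j)"
    by (intro mult_dvd_mono dvd_refl dvd_sum assms(3))
  ultimately show ?case
    using insert.IH assms(4) by (metis dvd_add)
qed simp

text \<open>
  A Cartan matrix of finite type with a chosen symmetrization \<open>d\<close>, normalized so that
  \<open>(\<alpha>\<^sub>i, \<alpha>\<^sub>i) = 2 d\<^sub>i\<close> for the invariant form defined below.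
\<close>

locale symmetrized_cartan_matrix =
  fixes a :: "'i::finite \<Rightarrow> 'i \<Rightarrow> int" and d :: "'i \<Rightarrow> int"
  assumes diag: "a i i = 2"
    and off_diag: "i \<noteq> j \<Longrightarrow> a i j \<le> 0"
    and d_pos: "d i > 0"
    and d_sym: "d i * a i j = d j * a j i"
    and pos_def: "v \<noteq> 0 \<Longrightarrow>
      (\<Sum>i\<in>UNIV. \<Sum>j\<in>UNIV. of_int (d i * a i j) * v i * v j) > (0::real)"
begin

abbreviation pairing :: "'i \<Rightarrow> ('i \<Rightarrow> int) \<Rightarrow> int" where
  "pairing i x \<equiv> \<Sum>j\<in>UNIV. a i j * x j"

definition form :: "('i \<Rightarrow> int) \<Rightarrow> ('i \<Rightarrow> int) \<Rightarrow> int" where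
  "form x y = (\<Sum>i\<in>UNIV. \<Sum>j\<in>UNIV. d i * a i j * x i * y j)"

lemma form_pairing: "form x y = (\<Sum>i\<in>UNIV. d i * x i * pairing i y)"
  by (simp add: form_def sum_distrib_left mult_ac)

lemma form_sym: "form x y = form y x"
proof -
  have "form x y = (\<Sum>j\<in>UNIV. \<Sum>i\<in>UNIV. d i * a i j * x i * y j)"
    unfolding form_def by (rule sum.swap)
  also have "\<dots> = form y x"
    unfolding form_def
  proof (intro sum.cong refl)
    fix i j
    show "d i * a i j * x i * y j = d j * a j i * y j * x i"
      using d_sym[of i j] by (simp add: mult_ac)
  qed
  finally show ?thesis .
qed

lemma form_add_left: "form (\<lambda>j. x j + k * y j) z = form x z + k * form y z"
  by (simp add: form_pairing algebra_simps sum.distrib sum_distrib_left)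

lemma form_add_right: "form z (\<lambda>j. x j + k * y j) = form z x + k * form z y"
  using form_add_left form_sym by metis

lemma pairing_linear: "pairing i (\<lambda>j. x j + k * y j) = pairing i x + k * pairing i y"
  by (simp add: algebra_simps sum.distrib sum_distrib_left)

lemma pairing_simple_root: "pairing j (simple_root i) = a j i"
  by (simp add: simple_root_def if_distrib cong: if_cong)

lemma form_simple_root_left: "form (simple_root i) y = d i * pairing i y"
  by (simp add: form_pairing simple_root_def if_distrib if_distribR cong: if_cong)

lemma form_simple_root_right: "form y (simple_root i) = d i * pairing i y"
  using form_simple_root_left form_sym by metis

lemma form_simple_root: "form (simple_root i) (simple_root i) = 2 * d i"
  unfolding form_simple_root_left pairing_simple_root diag by simp

lemma form_reflection:
  "form (simple_reflection a i x) (simple_reflection a i y) = form x y"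
  unfolding simple_reflection_alt form_add_left form_add_right form_simple_root
  unfolding form_simple_root_left form_simple_root_right
  by (simp add: algebra_simps)

lemma form_word_product: "form (word_product a v x) (word_product a v y) = form x y"
  by (induction v) (simp_all add: form_reflection)

lemma form_pos:
  assumes "x \<noteq> 0"
  shows "form x x > 0"
proof -
  have "(\<lambda>i. real_of_int (x i)) \<noteq> 0"
    using assms by (auto simp: fun_eq_iff)
  from pos_def[OF this] have "real_of_int (form x x) > 0"
    by (simp add: form_def)
  then show ?thesis by simp
qed

lemma simple_reflection_involution:
  "simple_reflection a i (simple_reflection a i x) = x"
proof -
  have "pairing i (simple_reflection a i x) = - pairing i x"
    unfolding simple_reflection_alt pairing_linear pairing_simple_root diag by simp
  then show ?thesis
    unfolding simple_reflection_alt[of a i "simple_reflection a i x"]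
    by (simp add: simple_reflection_alt)
qed

lemma simple_reflection_simple_root:
  "simple_reflection a i (simple_root i) = (\<lambda>j. - simple_root i j)"
  unfolding simple_reflection_alt pairing_simple_root diag by simp

text \<open>
  The coroot of \<open>\<beta> = v \<alpha>\<^sub>i = \<Sum>\<^sub>j c\<^sub>j \<alpha>\<^sub>j\<close> is \<open>\<Sum>\<^sub>j (d\<^sub>j c\<^sub>j / d\<^sub>i) h\<^sub>j\<close>, so the divisibility says that the coroot
  lies in the lattice spanned by the simple coroots.
\<close>

lemma dvd_root_coefficient:
  "d i dvd d j * word_product a v (simple_root i) j"
proof (induction v arbitrary: j)
  case Nil
  then show ?case by (simp add: simple_root_def)
next
  case (Cons l v)
  let ?c = "word_product a v (simple_root i)"
  have "d l * pairing l ?c = (\<Sum>j\<in>UNIV. a j l * (d j * ?c j))"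
    using d_sym by (simp add: sum_distrib_left mult.assoc[symmetric])
       (metis mult.commute)
  then have "d i dvd d l * pairing l ?c"
    using Cons.IH by (simp add: dvd_sum)
  then have "d i dvd d l * (?c l - pairing l ?c)"
    using Cons.IH[of l] by (simp add: right_diff_distrib)
  with Cons.IH show ?case
    by (simp add: simple_reflection_def)
qed

lemma form_self_dvd:
  assumes "\<And>j. e dvd d j * x j"
  shows "2 * e dvd form x x"
  unfolding form_def
proof (rule dvd_double_sum_symmetric)
  show "finite (UNIV :: 'i set)" by simp
  fix i j
  show "d i * a i j * x i * x j = d j * a j i * x j * x i"
    using d_sym[of i j] by (simp add: mult_ac)
  have "e dvd (d i * x i) * (a i j * x j)" using assms by simp
  then show "e dvd d i * a i j * x i * x j" by (simp add: mult_ac)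
  have "2 * e dvd 2 * ((d i * x i) * x i)" using assms by simp
  then show "2 * e dvd d i * a i i * x i * x i" by (simp add: diag mult_ac)
qed

text \<open>
  Write the root as \<open>c = p - n\<close> with \<open>p\<close>, \<open>n\<close> nonnegative of disjoint support, so that \<open>(p, n) \<le> 0\<close> and
  \<open>(c, c) \<ge> (p, p) + (n, n)\<close>. The divisibility of the coefficients passes from \<open>c\<close> to \<open>p\<close> and \<open>n\<close>, so
  \<open>(p, p)\<close> and \<open>(n, n)\<close> are multiples of \<open>2 d\<^sub>i = (c, c)\<close>. By positive definiteness, one of \<open>p\<close>, \<open>n\<close>
  vanishes. Divisibility is what handles roots of different lengths, since the root lattice may contain
  nonzero vectors shorter than \<open>c\<close>.
\<close>

lemma root_nonneg_or_nonpos: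
  fixes v i
  defines "c \<equiv> word_product a v (simple_root i)"
  shows "(\<forall>j. 0 \<le> c j) \<or> (\<forall>j. c j \<le> 0)"
proof (rule ccontr)
  assume mixed: "\<not> ?thesis"
  define p where "p = (\<lambda>j. max (c j) 0)"
  define n where "n = (\<lambda>j. max (- c j) 0)"
  have "p \<noteq> 0" "n \<noteq> 0"
    using mixed by (auto simp: p_def n_def fun_eq_iff not_le max_def)
  have c: "c = (\<lambda>j. p j + (-1) * n j)"
    by (auto simp: p_def n_def)
  have big: "form x x \<ge> 2 * d i" if "x \<noteq> 0" "\<And>j. x j \<in> {c j, - c j, 0}" for x
  proof (rule zdvd_imp_le)
    show "2 * d i dvd form x x"
    proof (rule form_self_dvd)
      fix j
      show "d i dvd d j * x j"
        using that(2)[of j] dvd_root_coefficient[of i j v] by (auto simp: c_def)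
    qed
  qed (use form_pos that in auto)
  have cross: "form p n \<le> 0"
    unfolding form_def
  proof (intro sum_nonpos)
    fix k l
    show "d k * a k l * p k * n l \<le> 0"
    proof (cases "k = l")
      case True
      then show ?thesis by (simp add: p_def n_def max_def)
    next
      case False
      then have "d k * (p k * n l) * a k l \<le> 0"
        using off_diag[OF False] d_pos[of k]
        by (intro mult_nonneg_nonpos) (auto simp: p_def n_def)
      then show ?thesis by (simp add: mult_ac)
    qed
  qed
  have "form c c = form p p + form n n - 2 * form p n"
    unfolding c form_add_left form_add_right using form_sym[of n p] by simp
  moreover have "form c c = 2 * d i"
    unfolding c_def form_word_product form_simple_root ..
  moreover have "form p p \<ge> 2 * d i" "form n n \<ge> 2 * d i"
    using \<open>p \<noteq> 0\<close> \<open>n \<noteq> 0\<close> by (auto intro!: big simp: p_def n_def)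
  ultimately show False
    using cross d_pos[of i] by linarith
qed

text \<open>
  The reflections \<open>s\<^sub>j\<close> and \<open>v s\<^sub>i v\<^sup>-\<^sup>1\<close> agree, since both are the orthogonal reflection in the line
  spanned by \<open>v \<alpha>\<^sub>i\<close>.
\<close>

lemma reflection_word_product_commute:
  assumes c: "word_product a v (simple_root i) = (\<lambda>l. m * simple_root j l)"
    and m: "m \<noteq> 0"
  shows "simple_reflection a j (word_product a v x) = word_product a v (simple_reflection a i x)"
proof -
  have f: "form (\<lambda>l. m * simple_root j l) y = m * (d j * pairing j y)" for y
    using form_add_left[of "\<lambda>_. 0" m "simple_root j" y]
    by (simp add: form_simple_root_left) (simp add: form_def)
  have "2 * d i = form (word_product a v (simple_root i)) (word_product a v (simple_root i))"
    by (simp add: form_word_product form_simple_root)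
  also have "\<dots> = m * (d j * pairing j (\<lambda>l. m * simple_root j l))"
    unfolding c f ..
  also have "pairing j (\<lambda>l. m * simple_root j l) = m * 2"
    using pairing_simple_root[of j j] diag[of j]
    by (simp add: mult.left_commute flip: sum_distrib_left)
  finally have di: "d i = d j * m * m" by simp
  have "m * (d j * pairing j (word_product a v x)) = d i * pairing i x"
    using form_word_product[of v "simple_root i" x]
    unfolding c f form_simple_root_left .
  then have "(m * d j) * pairing j (word_product a v x) = (m * d j) * (m * pairing i x)"
    using di by (simp add: mult_ac)
  then have "pairing j (word_product a v x) = m * pairing i x"
    using m d_pos[of j] by simp
  then show ?thesis
    unfolding word_product_reflection c simple_reflection_alt[of a j] by (simp add: mult_ac)
qed

text \<open>
  Apply the letters of \<open>v\<close> to \<open>\<alpha>\<^sub>i\<close> from the right. At some letter \<open>j\<close> the root changes from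
  nonnegative to nonpositive; as \<open>s\<^sub>j\<close> changes only the coefficient at \<open>j\<close>, the root is then a multiple
  of \<open>\<alpha>\<^sub>j\<close>. Moving \<open>s\<^sub>j\<close> to the right end turns it into \<open>s\<^sub>i\<close>, which cancels the appended letter.
\<close>

lemma deletion:
  assumes "word_product a v (simple_root i) l < 0"
  shows "\<exists>v'. length v' < length v \<and> word_product a v' = word_product a (v @ [i])"
  using assms
proof (induction v arbitrary: l)
  case Nil
  then show ?case by (simp add: simple_root_def split: if_splits)
next
  case (Cons j v)
  let ?c = "word_product a v (simple_root i)"
  show ?case
  proof (cases "\<exists>l. ?c l < 0")
    case True
    then obtain v' where "length v' < length v" "word_product a v' = word_product a (v @ [i])"
      using Cons.IH by blast
    then show ?thesis by (intro exI[of _ "j # v'"]) simp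
  next
    case False
    then have nonneg: "0 \<le> ?c k" for k by (simp add: not_less)
    have reflected: "simple_reflection a j ?c k \<le> 0" for k
      using root_nonneg_or_nonpos[of "j # v" i] Cons.prems
      by (metis comp_apply not_less word_product_Cons)
    have c: "?c = (\<lambda>k. ?c j * simple_root j k)"
    proof
      fix k
      show "?c k = ?c j * simple_root j k"
        using reflected[of k] nonneg[of k]
        by (cases "k = j") (simp_all add: simple_root_def simple_reflection_def)
    qed
    have "?c j \<noteq> 0"
    proof
      assume "?c j = 0"
      with c have "?c = (\<lambda>_. 0)" by simp
      then show False
        using form_word_product[of v "simple_root i" "simple_root i"] d_pos[of i]
        by (simp add: form_simple_root form_def[of "\<lambda>_. 0"])
    qed
    then have "word_product a v = word_product a ((j # v) @ [i])"
      using reflection_word_product_commute[OF c]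
      by (simp add: word_product_append comp_def simple_reflection_involution)
    then show ?thesis by (intro exI[of _ v]) simp
  qed
qed

lemma weyl_length_le: "weyl_length a (word_product a v) \<le> length v"
  unfolding weyl_length_def by (rule Least_le) blast

lemma weyl_length_word:
  "\<exists>v. length v = weyl_length a (word_product a u) \<and> word_product a v = word_product a u"
  unfolding weyl_length_def by (rule LeastI) blast

lemma reduced_word_root_nonneg:
  assumes "reduced_word a g w" and k: "k < length w"
  shows "0 \<le> word_product a (take k w) (simple_root (w ! k)) l"
proof (rule ccontr)
  assume "\<not> ?thesis"
  then obtain v where v: "length v < length (take k w)"
      "word_product a v = word_product a (take k w @ [w ! k])"
    using deletion[of "take k w" "w ! k" l] by auto
  have "word_product a (v @ drop (Suc k) w) = word_product a w"
    unfolding word_product_append v(2)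
    unfolding word_product_append[symmetric]
    using id_take_nth_drop[OF k] by simp
  with assms have "length w \<le> length (v @ drop (Suc k) w)"
    unfolding reduced_word_def by (metis weyl_length_le)
  with v(1) k show False by simp
qed

text \<open>
  If \<open>i\<close> were missing from \<open>w\<close>, then \<open>w \<alpha>\<^sub>i\<close> would have coefficient 1 at \<open>i\<close>. A reduced word \<open>v\<close> of
  \<open>w s\<^sub>i\<close>, no longer than \<open>w\<close> by maximality, would then satisfy \<open>v \<alpha>\<^sub>i = - w \<alpha>\<^sub>i\<close>, so deletion would give
  a word of \<open>v s\<^sub>i = w\<close> shorter than \<open>w\<close>.
\<close>

lemma letter_in_longest_word:
  assumes "longest_element a g" "reduced_word a g w"
  shows "i \<in> set w"
proof (rule ccontr)
  assume i: "i \<notin> set w"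
  obtain v where v: "length v = weyl_length a (word_product a (w @ [i]))"
      "word_product a v = word_product a (w @ [i])"
    using weyl_length_word by blast
  have "length v \<le> length w"
    using assms v(1) by (auto simp: longest_element_def reduced_word_def weyl_group_def)
  have "word_product a v (simple_root i) i = -1"
    unfolding v(2) using i
    by (simp add: word_product_append simple_reflection_simple_root word_product_absent_letter)
       (simp add: simple_root_def)
  then obtain v' where v': "length v' < length v" "word_product a v' = word_product a (v @ [i])"
    using deletion[of v i i] by auto
  have "word_product a v' = word_product a w"
    unfolding v'(2) by (simp add: word_product_append v(2) fun_eq_iff simple_reflection_involution)
  then have "length w \<le> length v'"
    using assms(2) unfolding reduced_word_def by (metis weyl_length_le)
  with v'(1) \<open>length v \<le> length w\<close> show False by simp
qed


section \<open>Heights of the positive coroots\<close>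

text \<open>
  This is \<open>\<langle>s\<^bsub>i\<^sub>1\<^esub> \<cdots> s\<^bsub>i\<^sub>k\<^sub>-\<^sub>1\<^esub> h\<^bsub>i\<^sub>k\<^esub>, \<rho>\<rangle>\<close>, the sum of the coefficients \<open>d\<^sub>j c\<^sub>j / d\<^bsub>i\<^sub>k\<^esub>\<close> of the coroot
  belonging to the root \<open>\<Sum>\<^sub>j c\<^sub>j \<alpha>\<^sub>j = s\<^bsub>i\<^sub>1\<^esub> \<cdots> s\<^bsub>i\<^sub>k\<^sub>-\<^sub>1\<^esub> \<alpha>\<^bsub>i\<^sub>k\<^esub>\<close>. The quotient is exact.
\<close>

definition coroot_height :: "'i list \<Rightarrow> nat \<Rightarrow> int" where
  "coroot_height w k =
     (if k < length w
      then (\<Sum>j\<in>UNIV. d j * word_product a (take k w) (simple_root (w ! k)) j) div d (w ! k)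
      else 0)"

lemma coroot_height:
  assumes "k < length w"
  shows "d (w ! k) * coroot_height w k =
    (\<Sum>j\<in>UNIV. d j * word_product a (take k w) (simple_root (w ! k)) j)"
  using assms by (simp add: coroot_height_def dvd_sum dvd_root_coefficient)

text \<open>
  Telescoping: the \<open>l\<close>-th letter of the word contributes a multiple of the root
  \<open>s\<^bsub>i\<^sub>1\<^esub> \<cdots> s\<^bsub>i\<^sub>l\<^sub>-\<^sub>1\<^esub> \<alpha>\<^bsub>i\<^sub>l\<^esub>\<close>.
\<close>

lemma word_product_take:
  "k \<le> length w \<Longrightarrow> word_product a (take k w) x j =
     x j - (\<Sum>l<k. pairing (w ! l) x * word_product a (take l w) (simple_root (w ! l)) j)"
proof (induction k)
  case (Suc k)
  then have "take (Suc k) w = take k w @ [w ! k]"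
    by (simp add: take_Suc_conv_app_nth)
  then show ?case
    using Suc by (simp add: word_product_append word_product_reflection)
qed simp

text \<open>
  The telescoping formula for \<open>\<alpha>\<^bsub>i\<^sub>k\<^esub>\<close>, paired with \<open>\<rho>\<close>, reads
  \<open>height\<^sub>k = 1 - \<Sum>\<^sub>l\<^sub><\<^sub>k a\<^bsub>i\<^sub>k i\<^sub>l\<^esub> height\<^sub>l\<close>; the 1 is \<open>\<langle>h\<^bsub>i\<^sub>k\<^esub>, \<rho>\<rangle>\<close>.
\<close>

lemma sigma_coroot_height:
  assumes k: "k < length w"
  shows "sigma a w k (coroot_height w) = 1"
proof -
  let ?i = "w ! k" and ?\<beta> = "\<lambda>l. word_product a (take l w) (simple_root (w ! l))"
  have "d ?i * coroot_height w k =
      (\<Sum>j\<in>UNIV. d j * simple_root ?i j)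
      - (\<Sum>j\<in>UNIV. \<Sum>l<k. d j * (a (w ! l) ?i * ?\<beta> l j))"
    using k unfolding coroot_height[OF k]
    by (simp add: word_product_take[of k] pairing_simple_root right_diff_distrib
          sum_subtractf sum_distrib_left)
  also have "(\<Sum>j\<in>UNIV. d j * simple_root ?i j) = d ?i"
    by (simp add: simple_root_def if_distrib cong: if_cong)
  also have "(\<Sum>j\<in>UNIV. \<Sum>l<k. d j * (a (w ! l) ?i * ?\<beta> l j))
      = (\<Sum>l<k. a (w ! l) ?i * (\<Sum>j\<in>UNIV. d j * ?\<beta> l j))"
    by (subst sum.swap) (simp add: sum_distrib_left mult_ac)
  also have "\<dots> = (\<Sum>l<k. d ?i * (a ?i (w ! l) * coroot_height w l))"
  proof (intro sum.cong refl)
    fix l assume "l \<in> {..<k}"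
    then have "l < length w" using k by simp
    then show "a (w ! l) ?i * (\<Sum>j\<in>UNIV. d j * ?\<beta> l j)
        = d ?i * (a ?i (w ! l) * coroot_height w l)"
      using d_sym[of "w ! l" ?i] by (simp flip: coroot_height add: mult_ac)
  qed
  finally have "d ?i * sigma a w k (coroot_height w) = d ?i * 1"
    by (simp add: sigma_def distrib_left sum_distrib_left)
  then show ?thesis
    using d_pos[of ?i] by simp
qed

lemma coroot_height_pos:
  assumes "reduced_word a g w" and k: "k < length w"
  shows "0 < coroot_height w k"
proof -
  let ?c = "word_product a (take k w) (simple_root (w ! k))"
  have nonneg: "0 \<le> ?c j" for j
    by (rule reduced_word_root_nonneg[OF assms])
  have "?c \<noteq> (\<lambda>_. 0)"
  proof
    assume "?c = (\<lambda>_. 0)"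
    then show False
      using form_word_product[of "take k w" "simple_root (w ! k)" "simple_root (w ! k)"]
        d_pos[of "w ! k"]
      by (simp add: form_simple_root form_def[of "\<lambda>_. 0"])
  qed
  then obtain j where "?c j \<noteq> 0" by (auto simp: fun_eq_iff)
  with nonneg[of j] have "0 < d j * ?c j" using d_pos[of j] by simp
  moreover have "0 \<le> d l * ?c l" for l
    using nonneg[of l] d_pos[of l] by simp
  ultimately have "0 < (\<Sum>j\<in>UNIV. d j * ?c j)"
    by (intro sum_pos2[of _ j]) auto
  then have "0 < d (w ! k) * coroot_height w k"
    using coroot_height[OF k] by simp
  then show ?thesis
    using d_pos[of "w ! k"] by (simp add: zero_less_mult_iff)
qed

end


section \<open>Crystal operators\<close>

lemma sigma_linear:
  "sigma a w k (\<lambda>j. x j + m * y j) = sigma a w k x + m * sigma a w k y"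
  by (simp add: sigma_def algebra_simps sum.distrib sum_distrib_left)

lemma sigma_add: "sigma a w k (x + y) = sigma a w k x + sigma a w k y"
  using sigma_linear[of a w k x 1 y] by (simp add: plus_fun_def)

lemma sigma_update:
  "sigma a w l (x(k := x k + m)) =
     sigma a w l x + (if l = k then m else if k < l then a (w ! l) (w ! k) * m else 0)"
proof -
  have "(\<Sum>j<l. a (w ! l) (w ! j) * (x(k := x k + m)) j)
      = (\<Sum>j<l. a (w ! l) (w ! j) * x j) + (\<Sum>j<l. if j = k then a (w ! l) (w ! k) * m else 0)"
    unfolding sum.distrib[symmetric] by (intro sum.cong) (auto simp: algebra_simps)
  then show ?thesis
    by (auto simp: sigma_def)
qed

text \<open>
  This description avoids \<^const>\<open>Max\<close> and is correct also for a letter that does not occur, when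
  \<^const>\<open>eps\<close> is the maximum of an empty set.
\<close>

lemma eps_positions_iff:
  "k \<in> eps_positions a w i x \<longleftrightarrow>
     k < length w \<and> w ! k = i \<and> (\<forall>l<length w. w ! l = i \<longrightarrow> sigma a w l x \<le> sigma a w k x)"
proof -
  have fin: "finite {sigma a w k x |k. k < length w \<and> w ! k = i}" by simp
  show ?thesis
  proof (cases "k < length w \<and> w ! k = i")
    case True
    then have "sigma a w k x = eps a w i x \<longleftrightarrow>
        (\<forall>l<length w. w ! l = i \<longrightarrow> sigma a w l x \<le> sigma a w k x)"
      unfolding eps_def by (subst eq_commute, subst Max_eq_iff[OF fin]) auto
    with True show ?thesis by (simp add: eps_positions_def)
  qed (auto simp: eps_positions_def)
qed

lemma eps_positions_shift:
  assumes "\<And>k l. \<lbrakk>k < length w; l < length w; w ! k = w ! l\<rbrakk> \<Longrightarrow> sigma a w k h = sigma a w l h"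
  shows "eps_positions a w i (x + h) = eps_positions a w i x"
proof -
  have "sigma a w l (x + h) \<le> sigma a w k (x + h) \<longleftrightarrow> sigma a w l x \<le> sigma a w k x"
    if "k < length w" "l < length w" "w ! k = i" "w ! l = i" for k l
    using assms[of k l] that by (simp add: sigma_add)
  then show ?thesis
    by (auto simp: set_eq_iff eps_positions_iff)
qed

lemma crystal_operators_shift:
  assumes "\<And>k l. \<lbrakk>k < length w; l < length w; w ! k = w ! l\<rbrakk> \<Longrightarrow> sigma a w k h = sigma a w l h"
  shows "e_op a w i (x + h) = e_op a w i x + h"
    and "f_op a w i (x + h) = f_op a w i x + h"
  by (auto simp: e_op_def f_op_def Let_def eps_positions_shift[OF assms] fun_eq_iff)

text \<open>
  If \<open>k\<close> is the first maximum of \<open>\<sigma>\<close> for its letter, then lowering \<open>x\<^sub>k\<close> by 1 is the action of \<open>e\<^sub>i\<close>.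
  It decreases \<open>\<sigma>\<^sub>k\<close> by 1 and all later values by 2, so \<open>k\<close> becomes the last maximum and \<open>f\<^sub>i\<close> undoes
  the step.
\<close>

lemma f_op_raise:
  assumes diag: "\<And>i. a i i = 2"
    and k: "k < length w"
    and before: "\<And>l. \<lbrakk>l < k; w ! l = w ! k\<rbrakk> \<Longrightarrow> sigma a w l x < sigma a w k x"
    and after: "\<And>l. \<lbrakk>k < l; l < length w; w ! l = w ! k\<rbrakk> \<Longrightarrow> sigma a w l x \<le> sigma a w k x"
  shows "f_op a w (w ! k) (x(k := x k - 1)) = x"
proof -
  let ?y = "x(k := x k - 1)"
  have s: "sigma a w l ?y =
      sigma a w l x - (if l = k then 1 else if k < l then a (w ! l) (w ! k) else 0)" for l
    using sigma_update[of a w l x k "-1"] by simp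
  have "Max (eps_positions a w (w ! k) ?y) = k"
  proof (rule Max_eqI)
    show "finite (eps_positions a w (w ! k) ?y)"
      by (simp add: eps_positions_def)
    have "sigma a w l ?y \<le> sigma a w k ?y" if "l < length w" "w ! l = w ! k" for l
      using before[of l] after[of l] that diag[of "w ! k"]
      by (cases l k rule: linorder_cases) (auto simp: s)
    with k show "k \<in> eps_positions a w (w ! k) ?y"
      by (simp add: eps_positions_iff)
    fix l assume "l \<in> eps_positions a w (w ! k) ?y"
    then have l: "l < length w" "w ! l = w ! k" "sigma a w k ?y \<le> sigma a w l ?y"
      using k by (auto simp: eps_positions_iff)
    show "l \<le> k"
      using after[of l] l diag[of "w ! k"] by (rule_tac ccontr) (auto simp: s)
  qed
  then show ?thesis
    by (simp add: f_op_def)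
qed

lemma B_infinity_zero: "0 \<in> B_infinity a w"
  unfolding B_infinity_def by (auto intro: exI[of _ "[]"])

lemma B_infinity_f_op: "x \<in> B_infinity a w \<Longrightarrow> f_op a w i x \<in> B_infinity a w"
  unfolding B_infinity_def by (auto intro: exI[of _ "i # _"])

lemma B_infinity_raise:
  assumes "\<And>i. a i i = 2" and "k < length w"
    and "\<And>l. \<lbrakk>l < k; w ! l = w ! k\<rbrakk> \<Longrightarrow> sigma a w l x < sigma a w k x"
    and "\<And>l. \<lbrakk>k < l; l < length w; w ! l = w ! k\<rbrakk> \<Longrightarrow> sigma a w l x \<le> sigma a w k x"
    and "x(k := x k - 1) \<in> B_infinity a w"
  shows "x \<in> B_infinity a w"
proof -
  have "f_op a w (w ! k) (x(k := x k - 1)) = x"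
    by (rule f_op_raise) (fact assms)+
  with B_infinity_f_op[OF assms(5), of "w ! k"] show ?thesis
    by (simp only:)
qed

lemma B_infinity_subset_cellular_crystal:
  assumes "\<And>i. i \<in> set w"
  shows "B_infinity a w \<subseteq> cellular_crystal w"
proof -
  have step: "f_op a w i x \<in> cellular_crystal w" if "x \<in> cellular_crystal w" for i x
  proof -
    let ?P = "{k. k < length w \<and> w ! k = i}"
    have ne: "?P \<noteq> {}"
      using assms[of i] by (auto simp: in_set_conv_nth)
    define S where "S = (\<lambda>k. sigma a w k x) ` ?P"
    have fin: "finite S" by (simp add: S_def)
    have "Max S \<in> S"
      by (rule Max_in[OF fin]) (use ne in \<open>simp add: S_def\<close>)
    then obtain k where k: "Max S = sigma a w k x" "k \<in> ?P"
      unfolding S_def by (rule imageE)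
    have "sigma a w l x \<le> sigma a w k x" if "l \<in> ?P" for l
      unfolding k(1)[symmetric] by (rule Max_ge[OF fin]) (use that in \<open>simp add: S_def\<close>)
    with k(2) have "k \<in> eps_positions a w i x"
      by (simp add: eps_positions_iff)
    then have "Max (eps_positions a w i x) \<in> eps_positions a w i x"
      by (intro Max_in) (auto simp: eps_positions_def[of a w i x])
    with that show ?thesis
      by (auto simp: f_op_def Let_def cellular_crystal_def eps_positions_def)
  qed
  have "foldr (f_op a w) js 0 \<in> cellular_crystal w" for js
    by (induction js) (simp_all add: step, simp add: cellular_crystal_def)
  then show ?thesis by (auto simp: B_infinity_def)
qed


section \<open>The lattice of shifts\<close>

lemma next_pos_properties:
  shows "k < next_pos w k"
    and "next_pos w k < length w \<Longrightarrow> w ! next_pos w k = w ! k"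
    and "\<lbrakk>k < l; w ! l = w ! k\<rbrakk> \<Longrightarrow> next_pos w k \<le> l"
proof -
  have "k < next_pos w k \<and> (next_pos w k < length w \<longrightarrow> w ! next_pos w k = w ! k)"
    unfolding next_pos_def
    by (rule LeastI[of _ "Suc (k + length w)"]) simp
  then show "k < next_pos w k" "next_pos w k < length w \<Longrightarrow> w ! next_pos w k = w ! k"
    by auto
  show "next_pos w k \<le> l" if "k < l" "w ! l = w ! k"
    unfolding next_pos_def using that by (intro Least_le) simp
qed

lemma sigma_next_pos:
  assumes diag: "\<And>i. a i i = 2" and m: "next_pos w k < length w"
  shows "sigma a w (next_pos w k) x = sigma a w k x + beta a w k x"
proof -
  let ?m = "next_pos w k" and ?g = "\<lambda>j. a (w ! k) (w ! j) * x j"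
  have "{..<?m} = insert k ({..<k} \<union> {k<..<?m})"
    using next_pos_properties(1)[of k w] by auto
  moreover have "sum ?g ({..<k} \<union> {k<..<?m}) = sum ?g {..<k} + sum ?g {k<..<?m}"
    by (rule sum.union_disjoint) auto
  ultimately have "sum ?g {..<?m} = ?g k + (sum ?g {..<k} + sum ?g {k<..<?m})"
    by simp
  then show ?thesis
    using next_pos_properties(2)[OF m] diag[of "w ! k"]
    by (simp add: sigma_def beta_def)
qed

text \<open>
  Together with \<open>H_latticeI\<close> this characterizes the lattice: its points are those for which \<open>\<sigma>\<^sub>k\<close>
  depends only on the letter at \<open>k\<close>.
\<close>

lemma H_lattice_sigma:
  assumes diag: "\<And>i. a i i = 2" and h: "h \<in> H_lattice a w"
    and "k < length w" "l < length w" "w ! k = w ! l"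
  shows "sigma a w k h = sigma a w l h"
proof -
  have le: "sigma a w k h = sigma a w l h"
    if "k \<le> l" "l < length w" "w ! k = w ! l" for k l
    using that
  proof (induction "l - k" arbitrary: k rule: less_induct)
    case less
    show ?case
    proof (cases "k = l")
      case False
      let ?m = "next_pos w k"
      have m: "k < ?m" "?m \<le> l"
        using next_pos_properties(1)[of k w] next_pos_properties(3)[of k l w] False less.prems
        by auto
      then have "sigma a w ?m h = sigma a w l h"
        using less.prems next_pos_properties(2)[of w k] by (intro less.hyps) auto
      moreover have "sigma a w ?m h = sigma a w k h"
        using sigma_next_pos[of a w k h] diag h m less.prems
        by (auto simp: H_lattice_def)
      ultimately show ?thesis by simp
    qed simp
  qed
  show ?thesis
    using le assms(3-5) by (metis nat_le_linear)
qed

lemma H_latticeI: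
  assumes "\<And>i. a i i = 2" and "h \<in> cellular_crystal w"
    and "\<And>k l. \<lbrakk>k < length w; l < length w; w ! k = w ! l\<rbrakk> \<Longrightarrow> sigma a w k h = sigma a w l h"
  shows "h \<in> H_lattice a w"
proof -
  have "beta a w k h = 0" if "k < length w" "next_pos w k < length w" for k
    using sigma_next_pos[of a w k h] assms(1) assms(3)[of k "next_pos w k"]
      next_pos_properties(2)[of w k] that by simp
  with assms(2) show ?thesis by (simp add: H_lattice_def)
qed


section \<open>Large multiples of a positive shift\<close>

locale positive_shift =
  fixes a :: "'i \<Rightarrow> 'i \<Rightarrow> int" and w :: "'i list" and h :: "nat \<Rightarrow> int"
  assumes diag: "a i i = 2"
    and h_cell: "h \<in> cellular_crystal w"
    and h_sigma: "\<lbrakk>k < length w; l < length w; w ! k = w ! l\<rbrakk> \<Longrightarrow> sigma a w k h = sigma a w l h"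
    and h_pos: "k < length w \<Longrightarrow> 0 < h k"
begin

definition suffix_part :: "nat \<Rightarrow> (nat \<Rightarrow> int) \<Rightarrow> nat \<Rightarrow> int" where
  "suffix_part k x = (\<lambda>j. if j < k then 0 else x j)"

text \<open>
  The state of the lowering process on \<open>y + n h\<close> once the coordinates before \<open>k\<close> have reached 0. The
  parameter \<open>n\<close> is kept separate from \<open>y\<close> because the steps that change later coordinates act on \<open>y\<close>
  alone, in the same way for all large \<open>n\<close>.
\<close>

definition shifted_suffix :: "nat \<Rightarrow> (nat \<Rightarrow> int) \<Rightarrow> nat \<Rightarrow> nat \<Rightarrow> int" where
  "shifted_suffix k y n = suffix_part k (\<lambda>j. y j + int n * h j)"

lemma sigma_suffix_part_before: "l < k \<Longrightarrow> sigma a w l (suffix_part k x) = 0"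
  by (simp add: sigma_def suffix_part_def)

lemma sigma_suffix_part_at: "sigma a w k (suffix_part k x) = x k"
  by (simp add: sigma_def suffix_part_def)

lemma sigma_suffix_part:
  assumes "k \<le> l"
  shows "sigma a w l x = sigma a w l (suffix_part k x) + (\<Sum>j<k. a (w ! l) (w ! j) * x j)"
proof -
  have "(\<Sum>j<l. a (w ! l) (w ! j) * x j) =
      (\<Sum>j<l. a (w ! l) (w ! j) * suffix_part k x j)
      + (\<Sum>j<l. if j \<in> {..<k} then a (w ! l) (w ! j) * x j else 0)"
    unfolding sum.distrib[symmetric] by (intro sum.cong) (auto simp: suffix_part_def)
  also have "(\<Sum>j<l. if j \<in> {..<k} then a (w ! l) (w ! j) * x j else 0)
      = (\<Sum>j\<in>{..<l} \<inter> {..<k}. a (w ! l) (w ! j) * x j)"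
    by (rule sum.inter_restrict[symmetric]) simp
  also have "{..<l} \<inter> {..<k} = {..<k}" using assms by auto
  finally show ?thesis
    using assms by (simp add: sigma_def suffix_part_def)
qed

text \<open>
  The added amount \<open>n h\<^sub>k\<close> is the same for all occurrences \<open>l \<ge> k\<close> of the letter at \<open>k\<close>, so the
  differences of their \<open>\<sigma>\<close> values do not involve \<open>n\<close>: since \<open>\<sigma>\<^sub>l(h) = \<sigma>\<^sub>k(h)\<close> and the part of \<open>h\<close> before
  \<open>k\<close> contributes equally to both, the truncation of \<open>h\<close> has \<open>\<sigma>\<^sub>l\<close> equal to its \<open>\<sigma>\<^sub>k\<close>, which is \<open>h\<^sub>k\<close>.
\<close>

lemma sigma_shifted_suffix:
  assumes "k \<le> l" "l < length w" "w ! l = w ! k"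
  shows "sigma a w l (shifted_suffix k y n) = sigma a w l (suffix_part k y) + int n * h k"
proof -
  have "sigma a w l (suffix_part k h) = sigma a w k (suffix_part k h)"
    using sigma_suffix_part[of k l h] sigma_suffix_part[of k k h] h_sigma[of k l] assms by simp
  then have "sigma a w l (suffix_part k h) = h k"
    by (simp add: sigma_suffix_part_at)
  moreover have "shifted_suffix k y n = (\<lambda>j. suffix_part k y j + int n * suffix_part k h j)"
    by (auto simp: shifted_suffix_def suffix_part_def)
  ultimately show ?thesis by (simp add: sigma_linear)
qed

lemma sigma_shifted_suffix_before: "l < k \<Longrightarrow> sigma a w l (shifted_suffix k y n) = 0"
  by (simp add: shifted_suffix_def sigma_suffix_part_before)

lemma shift_dominates:
  assumes "k < length w" and "nat \<bar>m\<bar> < n"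
  shows "0 < m + int n * h k"
proof -
  have "\<bar>m\<bar> < int n" using assms(2) by linarith
  also have "int n * 1 \<le> int n * h k"
    using h_pos[OF assms(1)] by (intro mult_left_mono) auto
  finally show ?thesis by simp
qed

text \<open>
  Once \<open>\<sigma>\<^sub>k\<close> dominates the later values of its letter, it continues to do so while the \<open>k\<close>-th
  coordinate goes down to 0, because each step costs \<open>\<sigma>\<^sub>k\<close> only 1 and the later values 2. As long as
  this coordinate is positive, \<open>\<sigma>\<^sub>k\<close> also exceeds the earlier values, which are 0.
\<close>

lemma shifted_suffix_balanced:
  assumes k: "k < length w"
    and balanced: "\<And>l. \<lbrakk>k < l; l < length w; w ! l = w ! k\<rbrakk> \<Longrightarrow>
      sigma a w l (suffix_part k y) \<le> y k"
    and nonneg: "0 \<le> y k + int n * h k"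
    and tail: "shifted_suffix (Suc k) y n \<in> B_infinity a w"
  shows "shifted_suffix k y n \<in> B_infinity a w"
proof -
  let ?x = "shifted_suffix k y n"
  have xk: "?x k = y k + int n * h k"
    by (simp add: shifted_suffix_def suffix_part_def)
  \<comment> \<open>The points met while lowering coordinate \<open>k\<close> from \<open>?x k\<close> to \<open>0\<close>, listed from the bottom.\<close>
  have "?x(k := int q) \<in> B_infinity a w" if "int q \<le> ?x k" for q
    using that
  proof (induction q)
    case 0
    have "?x(k := 0) = shifted_suffix (Suc k) y n"
      by (auto simp: shifted_suffix_def suffix_part_def fun_eq_iff less_Suc_eq)
    with tail show ?case by simp
  next
    case (Suc q)
    define c where "c = int (Suc q) - ?x k"
    define z where "z = ?x(k := int (Suc q))"
    have z: "z = ?x(k := ?x k + c)" by (simp add: z_def c_def)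
    have s: "sigma a w l z = sigma a w l ?x
        + (if l = k then c else if k < l then a (w ! l) (w ! k) * c else 0)" for l
      unfolding z by (rule sigma_update)
    have sk: "sigma a w k z = int (Suc q)"
      using sigma_shifted_suffix[of k k y n] k
      by (simp add: s sigma_suffix_part_at xk c_def)
    have "z \<in> B_infinity a w"
    proof (rule B_infinity_raise[where k = k])
      show "sigma a w l z < sigma a w k z" if "l < k" for l
        unfolding sk using that by (simp add: s sigma_shifted_suffix_before)
      show "sigma a w l z \<le> sigma a w k z"
        if "k < l" "l < length w" "w ! l = w ! k" for l
        using balanced[OF that] sigma_shifted_suffix[of k l y n] that Suc.prems diag[of "w ! k"]
        unfolding sk by (simp add: s xk c_def)
      show "z(k := z k - 1) \<in> B_infinity a w"
      proof -
        have "z(k := z k - 1) = ?x(k := int q)" by (simp add: z_def)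
        moreover have "?x(k := int q) \<in> B_infinity a w"
          using Suc.prems by (intro Suc.IH) simp
        ultimately show ?thesis by (simp only:)
      qed
    qed (use k diag in auto)
    then show ?case by (simp only: z_def)
  qed
  from this[of "nat (?x k)"] have "?x(k := ?x k) \<in> B_infinity a w"
    using nonneg by (simp only: xk int_nat_eq if_True order_refl)
  then show ?thesis by (simp only: fun_upd_triv)
qed

text \<open>
  Induction on the total excess of the later \<open>\<sigma>\<^sub>l\<close> over \<open>\<sigma>\<^sub>k\<close>. If it is zero, coordinate \<open>k\<close> can be
  lowered to 0 and the hypothesis on the suffixes from \<open>k + 1\<close> takes over. Otherwise the first maximum
  among the occurrences from \<open>k\<close> on is at some \<open>l > k\<close> not depending on \<open>n\<close>; for large \<open>n\<close> it also
  exceeds the value 0 at the earlier occurrences, so coordinate \<open>l\<close> may be lowered, which reduces the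
  excess.
\<close>

lemma shifted_suffix_step:
  assumes k: "k < length w"
    and IH: "\<And>y. y \<in> cellular_crystal w \<Longrightarrow>
      \<exists>n0. \<forall>n\<ge>n0. shifted_suffix (Suc k) y n \<in> B_infinity a w"
    and y: "y \<in> cellular_crystal w"
  shows "\<exists>n0. \<forall>n\<ge>n0. shifted_suffix k y n \<in> B_infinity a w"
proof -
  define L where "L = {l. k < l \<and> l < length w \<and> w ! l = w ! k}"
  define excess where "excess = (\<lambda>y l. nat (sigma a w l (suffix_part k y) - y k))"
  have fin: "finite L" by (simp add: L_def)
  show ?thesis
    using y
  proof (induction "\<Sum>l\<in>L. excess y l" arbitrary: y rule: less_induct)
    case less
    let ?s = "\<lambda>l. sigma a w l (suffix_part k y)"
    show ?case
    proof (cases "\<forall>l\<in>L. ?s l \<le> y k")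
      case True
      obtain n0 where n0: "\<And>n. n \<ge> n0 \<Longrightarrow> shifted_suffix (Suc k) y n \<in> B_infinity a w"
        using IH[OF less.prems] by blast
      have "shifted_suffix k y n \<in> B_infinity a w" if "n \<ge> max n0 (Suc (nat \<bar>y k\<bar>))" for n
      proof (rule shifted_suffix_balanced[OF k])
        show "0 \<le> y k + int n * h k"
          using shift_dominates[OF k, of "y k" n] that by simp
      qed (use True n0 that in \<open>auto simp: L_def\<close>)
      then show ?thesis by blast
    next
      case False
      \<comment> \<open>\<open>l\<close> is the first maximum of \<open>\<sigma>\<close> on \<open>L\<close>.\<close>
      define M where "M = Max (?s ` L)"
      define l where "l = (LEAST l. l \<in> L \<and> ?s l = M)"
      have "M \<in> ?s ` L"
        unfolding M_def using False fin by (intro Max_in) auto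
      then obtain j where "j \<in> L \<and> ?s j = M" by blast
      then have "l \<in> L \<and> ?s l = M"
        unfolding l_def by (rule LeastI)
      then have lL: "l \<in> L" and sl: "?s l = M" by auto
      have le: "?s j \<le> ?s l" if "j \<in> L" for j
        using that fin unfolding sl M_def by simp
      have lt: "?s j < ?s l" if "j \<in> L" "j < l" for j
        using le[OF that(1)] not_less_Least[of j "\<lambda>l. l \<in> L \<and> ?s l = M"] that
        unfolding sl l_def[symmetric] by (auto simp: order_less_le)
      have gt: "y k < ?s l"
        using False le by (auto simp: not_le intro: less_le_trans)
      have l: "k < l" "l < length w" "w ! l = w ! k"
        using lL by (auto simp: L_def)
      let ?y = "y(l := y l - 1)"
      have upd: "suffix_part k ?y = (suffix_part k y)(l := suffix_part k y l + - 1)"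
        using l by (auto simp: suffix_part_def)
      have s': "sigma a w j (suffix_part k ?y) =
          ?s j + (if j = l then - 1 else if l < j then a (w ! j) (w ! l) * - 1 else 0)" for j
        unfolding upd sigma_update ..
      have "(\<Sum>j\<in>L. excess ?y j) < (\<Sum>j\<in>L. excess y j)"
      proof (rule sum_strict_mono_ex1[OF fin])
        show "\<forall>j\<in>L. excess ?y j \<le> excess y j"
          using diag[of "w ! k"] l by (auto simp: excess_def s' L_def nat_mono)
        show "\<exists>j\<in>L. excess ?y j < excess y j"
          using gt l by (intro bexI[OF _ lL]) (simp add: excess_def s')
      qed
      moreover have "?y \<in> cellular_crystal w"
        using less.prems l by (auto simp: cellular_crystal_def)
      ultimately obtain n0 where
        n0: "\<And>n. n \<ge> n0 \<Longrightarrow> shifted_suffix k ?y n \<in> B_infinity a w"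
        using less.hyps by blast
      have "shifted_suffix k y n \<in> B_infinity a w" if n: "n \<ge> max n0 (Suc (nat \<bar>y k\<bar>))" for n
      proof (rule B_infinity_raise[where k = l])
        let ?x = "shifted_suffix k y n"
        have sx: "sigma a w j ?x = ?s j + int n * h k"
          if "k \<le> j" "j < length w" "w ! j = w ! k" for j
          using sigma_shifted_suffix that by blast
        have pos: "0 < y k + int n * h k"
          using shift_dominates[OF k, of "y k" n] n by simp
        show "sigma a w j ?x < sigma a w l ?x" if j: "j < l" "w ! j = w ! l" for j
        proof (cases j k rule: linorder_cases)
          case less
          then show ?thesis using sx[of l] l gt pos
            by (simp add: sigma_shifted_suffix_before)
        next
          case equal
          then show ?thesis using sx[of l] sx[of k] k l gt
            by (simp add: sigma_suffix_part_at)
        next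
          case greater
          then show ?thesis using sx[of l] sx[of j] j l lt[of j]
            by (simp add: L_def)
        qed
        show "sigma a w j ?x \<le> sigma a w l ?x"
          if j: "l < j" "j < length w" "w ! j = w ! l" for j
          using sx[of l] sx[of j] j l le[of j] by (simp add: L_def)
        have "?x(l := ?x l - 1) = shifted_suffix k ?y n"
          using l by (auto simp: shifted_suffix_def suffix_part_def)
        then show "?x(l := ?x l - 1) \<in> B_infinity a w"
          using n0[of n] n by simp
      qed (use l diag in auto)
      then show ?thesis by blast
    qed
  qed
qed

lemma deep_shift_in_B_infinity:
  assumes "y \<in> cellular_crystal w"
  shows "\<exists>n0. \<forall>n\<ge>n0. (\<lambda>j. y j + int n * h j) \<in> B_infinity a w"
proof -
  have "\<exists>n0. \<forall>n\<ge>n0. shifted_suffix k y n \<in> B_infinity a w" if "k \<le> length w" for k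
    using that assms
  proof (induction k arbitrary: y rule: inc_induct)
    case base
    then have "shifted_suffix (length w) y n = 0" for n
      using h_cell by (auto simp: shifted_suffix_def suffix_part_def cellular_crystal_def fun_eq_iff)
    then have "shifted_suffix (length w) y n \<in> B_infinity a w" for n
      using B_infinity_zero[of a w] by simp
    then show ?case by blast
  next
    case (step k)
    then show ?case using shifted_suffix_step by blast
  qed
  from this[of 0] show ?thesis
    by (simp add: shifted_suffix_def suffix_part_def)
qed

end

lemma simple_cartan_matrix_symmetrized:
  assumes "simple_cartan_matrix a"
  obtains d where "symmetrized_cartan_matrix a d"
  using assms
  unfolding simple_cartan_matrix_def cartan_matrix_def finite_type_def symmetrized_cartan_matrix_def
  by blast


section \<open>Shifting the realization\<close>

theorem proposition3p12:
  fixes a :: "'i::finite \<Rightarrow> 'i \<Rightarrow> int"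
    and w0 :: "('i \<Rightarrow> int) \<Rightarrow> ('i \<Rightarrow> int)"
    and w :: "'i list"
  assumes "simple_cartan_matrix a"
    and "longest_element a w0"
    and "reduced_word a w0 w"
  shows "(\<forall>h\<in>H_lattice a w. \<forall>x\<in>B_infinity a w. \<forall>i.
            e_op a w i (x + h) = e_op a w i x + h \<and>
            f_op a w i (x + h) = f_op a w i x + h)
       \<and> (\<forall>h\<in>H_lattice a w. B_infinity a w \<inter> B_infinity_shift a w h \<noteq> {})
       \<and> cellular_crystal w = (\<Union>h\<in>H_lattice a w. B_infinity_shift a w h)"
proof -
  obtain d where "symmetrized_cartan_matrix a d"
    using simple_cartan_matrix_symmetrized[OF assms(1)] .
  then interpret symmetrized_cartan_matrix a d .
  define h0 where "h0 = coroot_height w"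
  interpret positive_shift a w h0
    unfolding h0_def
    by unfold_locales
       (use coroot_height_pos[OF assms(3)] in
         \<open>auto simp: diag sigma_coroot_height cellular_crystal_def coroot_height_def\<close>)
  have zero: "0 \<in> cellular_crystal w" by (simp add: cellular_crystal_def)
  have B: "B_infinity a w \<subseteq> cellular_crystal w"
    by (rule B_infinity_subset_cellular_crystal) (rule letter_in_longest_word[OF assms(2,3)])
  have H: "H_lattice a w \<subseteq> cellular_crystal w" by (auto simp: H_lattice_def)

  have "e_op a w i (x + h) = e_op a w i x + h \<and> f_op a w i (x + h) = f_op a w i x + h"
    if "h \<in> H_lattice a w" for h x i
    using crystal_operators_shift[OF H_lattice_sigma[OF _ that]] diag by blast
  moreover
  have "B_infinity a w \<inter> B_infinity_shift a w h \<noteq> {}" if h: "h \<in> H_lattice a w" for h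
  proof -
    obtain n1 where n1: "\<And>n. n \<ge> n1 \<Longrightarrow> (\<lambda>j. h j + int n * h0 j) \<in> B_infinity a w"
      using deep_shift_in_B_infinity[of h] h H by blast
    obtain n2 where n2: "\<And>n. n \<ge> n2 \<Longrightarrow> (\<lambda>j. 0 j + int n * h0 j) \<in> B_infinity a w"
      using deep_shift_in_B_infinity[OF zero] by blast
    define n where "n = max n1 n2"
    have "(\<lambda>j. h j + int n * h0 j) = (\<lambda>j. 0 j + int n * h0 j) + h"
      by (simp add: fun_eq_iff)
    then have "(\<lambda>j. h j + int n * h0 j) \<in> B_infinity_shift a w h"
      unfolding B_infinity_shift_def using n2[of n] unfolding n_def by auto
    moreover have "(\<lambda>j. h j + int n * h0 j) \<in> B_infinity a w"
      using n1[of n] by (simp add: n_def)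
    ultimately show ?thesis by blast
  qed
  moreover have "cellular_crystal w = (\<Union>h\<in>H_lattice a w. B_infinity_shift a w h)"
  proof (intro equalityI subsetI)
    fix x assume "x \<in> cellular_crystal w"
    then obtain n where n: "(\<lambda>j. x j + int n * h0 j) \<in> B_infinity a w"
      using deep_shift_in_B_infinity by blast
    let ?h = "\<lambda>j. 0 j + (- int n) * h0 j"
    have "?h \<in> H_lattice a w"
    proof (rule H_latticeI[OF diag])
      show "?h \<in> cellular_crystal w"
        using h_cell by (simp add: cellular_crystal_def)
      show "sigma a w k ?h = sigma a w l ?h"
        if "k < length w" "l < length w" "w ! k = w ! l" for k l
        unfolding sigma_linear using h_sigma[OF that] by (simp add: sigma_def)
    qed
    moreover have "x = (\<lambda>j. x j + int n * h0 j) + ?h"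
      by (simp add: fun_eq_iff)
    ultimately show "x \<in> (\<Union>h\<in>H_lattice a w. B_infinity_shift a w h)"
      unfolding B_infinity_shift_def using n by blast
  next
    fix x assume "x \<in> (\<Union>h\<in>H_lattice a w. B_infinity_shift a w h)"
    then show "x \<in> cellular_crystal w"
      using B H by (auto simp: B_infinity_shift_def cellular_crystal_def subset_iff)
  qed
  ultimately show ?thesis by blast
qed

end
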